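(* Let $\lambda,\mu\in\mathbb{C}^*$, $\alpha,\beta\in\mathbb{C}$, $h(t),g(t)\in\mathbb{C}[t]$. Then: (i) $\Pi\big(\Omega_{\mathfrak{S}^0}(\lambda,\alpha,h)\big)\not\cong\Omega_{\mathfrak{S}^0}(\lambda',\alpha',h')$ for any $\lambda'\in\mathbb{C}^*$, $\alpha'\in\mathbb{C}$, $h'(t)\in\mathbb{C}[t]$; (ii) $\Omega_{\mathfrak{S}^0}(\lambda,\alpha,h)\cong\Omega_{\mathfrak{S}^0}(\mu,\beta,g)$ if and only if $\lambda=\mu$, $\alpha=\beta$ and $h=g$.
   Context: All vector spaces are over $\mathbb{C}$. The Ramond type super-BMS$_3$ algebra $\mathfrak{S}^0$ is the Lie superalgebra with basis $\{L_m,W_m,G_m,C_1,C_2\mid m\in\mathbb{Z}\}$, where $L_m,W_m,C_1,C_2$ are even, the $G_m$ are odd, $C_1,C_2$ are central, and the non-trivial brackets are $$[L_m,L_n]=(n-m)L_{m+n}+\tfrac{n^3-n}{12}\delta_{m+n,0}C_1,\quad [L_m,W_n]=(n-m)W_{m+n}+\tfrac{n^3-n}{12}\delta_{m+n,0}C_2,$$ $$[L_m,G_r]=(r-\tfrac m2)G_{m+r},\quad [G_r,G_s]=2W_{r+s}+\tfrac13(r^2-\tfrac14)\delta_{r+s,0}C_2.$$ Modules over a Lie superalgebra are $\mathbb{Z}_2$-graded, with $x(yv)-(-1)^{|x||y|}y(xv)=[x,y]v$ for homogeneous $x,y$. $\Pi$ is the parity-change functor, which interchanges the even and odd parts of a module.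 $\cong$ denotes isomorphism of modules by a parity-preserving (even) map. For $h(t)\in\mathbb{C}[t]$, $\alpha\in\mathbb{C}$ and $m\in\mathbb{Z}$, $h_m(t)=m\,h(t)-m(m-1)\alpha\,\frac{h(t)-h(\alpha)}{t-\alpha}\in\mathbb{C}[t]$. For $\lambda\in\mathbb{C}^*$, $\alpha\in\mathbb{C}$, $h\in\mathbb{C}[t]$, $\Omega_{\mathfrak{S}^0}(\lambda,\alpha,h)$ is the $\mathfrak{S}^0$-module with underlying space $V=\mathbb{C}[t^2,s]\oplus t\,\mathbb{C}[t^2,s]$, $V_{\bar 0}=\mathbb{C}[t^2,s]$, $V_{\bar 1}=t\,\mathbb{C}[t^2,s]$, and action (for $m\in\mathbb{Z}$, $f(t^2,s)\in\mathbb{C}[t^2,s]$; $\frac{\partial}{\partial t^2}$ is the partial derivative with respect to the variable $t^2$) $$L_m f(t^2,s)=\lambda^m(s+h_m(t^2))f(t^2,s-m)-m\lambda^m(t^2-m\alpha)\tfrac{\partial}{\partial t^2}(f(t^2,s-m)),$$ $$L_m\, tf(t^2,s)=\lambda^m(s-\tfrac m2+h_m(t^2))tf(t^2,s-m)-m\lambda^m(t^2-m\alpha)t\tfrac{\partial}{\partial t^2}f(t^2,s-m),$$ $$W_m f(t^2,s)=\lambda^m(t^2-m\alpha)f(t^2,s-m),\quad W_m\, tf(t^2,s)=\lambda^m(t^2-m\alpha)tf(t^2,s-m),$$ $$G_m f(t^2,s)=\lambda^m tf(t^2,s-m),\quad G_m\, tf(t^2,s)=\lambda^m(t^2-2m\alpha)f(t^2,s-m),$$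 with $C_1,C_2$ acting as $0$. *)

theory Defs
  imports
    "HOL-Computational_Algebra.Computational_Algebra"
    "HOL-Library.Poly_Mapping"
    "HOL-Library.Product_Plus"
    "HOL-Library.Z2"
begin

section \<open>Lie superalgebras and their modules\<close>

text \<open>
  Parities are elements of \<^typ>\<open>bit\<close>, the field with two elements. The carrier of every
  structure below is a whole type; the complex scalar multiplication is a component of the record.
\<close>

record 'v superspace =
  scale :: "complex \<Rightarrow> 'v \<Rightarrow> 'v"
  part :: "bit \<Rightarrow> 'v set"

record 'g superalgebra = "'g superspace" +
  bracket :: "'g \<Rightarrow> 'g \<Rightarrow> 'g"

record ('g, 'v) supermodule = "'v superspace" +
  act :: "'g \<Rightarrow> 'v \<Rightarrow> 'v"

definition super_vector_space :: "('v::ab_group_add, 'z) superspace_scheme \<Rightarrow> bool" where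
  "super_vector_space V \<longleftrightarrow>
     vector_space (scale V) \<and>
     (\<forall>p. module.subspace (scale V) (part V p)) \<and>
     part V 0 \<inter> part V 1 = {0} \<and>
     (\<forall>v. \<exists>a\<in>part V 0. \<exists>b\<in>part V 1. v = a + b)"

definition koszul_sign :: "bit \<Rightarrow> bit \<Rightarrow> complex" where
  "koszul_sign p q = (if p = 1 \<and> q = 1 then - 1 else 1)"

definition lie_superalgebra :: "'g::ab_group_add superalgebra \<Rightarrow> bool" where
  "lie_superalgebra A \<longleftrightarrow>
     super_vector_space A \<and>
     (\<forall>x. Vector_Spaces.linear (scale A) (scale A) (\<lambda>y. bracket A x y)) \<and>
     (\<forall>y. Vector_Spaces.linear (scale A) (scale A) (\<lambda>x. bracket A x y)) \<and>
     (\<forall>p q. \<forall>x\<in>part A p. \<forall>y\<in>part A q. bracket A x y \<in> part A (p + q)) \<and>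
     (\<forall>p q. \<forall>x\<in>part A p. \<forall>y\<in>part A q.
        bracket A x y = - scale A (koszul_sign p q) (bracket A y x)) \<and>
     (\<forall>p q. \<forall>x\<in>part A p. \<forall>y\<in>part A q. \<forall>z.
        bracket A x (bracket A y z) =
          bracket A (bracket A x y) z + scale A (koszul_sign p q) (bracket A y (bracket A x z)))"

definition is_supermodule ::
    "'g::ab_group_add superalgebra \<Rightarrow> ('g, 'v::ab_group_add) supermodule \<Rightarrow> bool" where
  "is_supermodule A M \<longleftrightarrow>
     super_vector_space M \<and>
     (\<forall>x. Vector_Spaces.linear (scale M) (scale M) (\<lambda>v. act M x v)) \<and>
     (\<forall>v. Vector_Spaces.linear (scale A) (scale M) (\<lambda>x. act M x v)) \<and>
     (\<forall>p q. \<forall>x\<in>part A p. \<forall>v\<in>part M q. act M x v \<in> part M (p + q)) \<and>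
     (\<forall>p q. \<forall>x\<in>part A p. \<forall>y\<in>part A q. \<forall>v.
        act M x (act M y v) - scale M (koszul_sign p q) (act M y (act M x v)) =
          act M (bracket A x y) v)"

definition parity_change :: "('g, 'v) supermodule \<Rightarrow> ('g, 'v) supermodule" where
  "parity_change M = M\<lparr>part := \<lambda>p. part M (p + 1)\<rparr>"

definition isomorphic ::
    "('g, 'v::ab_group_add) supermodule \<Rightarrow> ('g, 'w::ab_group_add) supermodule \<Rightarrow> bool"
    (infix \<open>\<cong>\<close> 50) where
  "M \<cong> N \<longleftrightarrow>
     (\<exists>\<phi>. Vector_Spaces.linear (scale M) (scale N) \<phi> \<and> bij \<phi> \<and>
          (\<forall>p. \<phi> ` part M p \<subseteq> part N p) \<and>
          (\<forall>x v. \<phi> (act M x v) = act N x (\<phi> v)))"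

section \<open>The Ramond type super-BMS3 algebra\<close>

datatype sbms_basis = L int | W int | G int | C1 | C2

text \<open>Vectors are finitely supported families of coefficients with respect to the basis.\<close>

type_synonym sbms = "sbms_basis \<Rightarrow>\<^sub>0 complex"

fun parity :: "sbms_basis \<Rightarrow> bit" where
  "parity (G _) = 1"
| "parity _ = 0"

definition sbms_scale :: "complex \<Rightarrow> sbms \<Rightarrow> sbms" where
  "sbms_scale c x = Poly_Mapping.map ((*) c) x"

definition central :: "complex \<Rightarrow> int \<Rightarrow> sbms_basis \<Rightarrow> sbms" where
  "central c k z = (if k = 0 then Poly_Mapping.single z c else 0)"

fun basis_bracket :: "sbms_basis \<Rightarrow> sbms_basis \<Rightarrow> sbms" where
  "basis_bracket (L m) (L n) =
     Poly_Mapping.single (L (m + n)) (of_int (n - m)) + central (of_int (n^3 - n) / 12) (m + n) C1"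
| "basis_bracket (L m) (W n) =
     Poly_Mapping.single (W (m + n)) (of_int (n - m)) + central (of_int (n^3 - n) / 12) (m + n) C2"
| "basis_bracket (W n) (L m) =
     - (Poly_Mapping.single (W (m + n)) (of_int (n - m)) + central (of_int (n^3 - n) / 12) (m + n) C2)"
| "basis_bracket (L m) (G r) = Poly_Mapping.single (G (m + r)) (of_int r - of_int m / 2)"
| "basis_bracket (G r) (L m) = - Poly_Mapping.single (G (m + r)) (of_int r - of_int m / 2)"
| "basis_bracket (G r) (G s) =
     Poly_Mapping.single (W (r + s)) 2 + central (1 / 3 * ((of_int r)^2 - 1 / 4)) (r + s) C2"
| "basis_bracket _ _ = 0"

definition sbms_bracket :: "sbms \<Rightarrow> sbms \<Rightarrow> sbms" where
  "sbms_bracket x y =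
     (\<Sum>a\<in>Poly_Mapping.keys x. \<Sum>b\<in>Poly_Mapping.keys y. sbms_scale (Poly_Mapping.lookup x a * Poly_Mapping.lookup y b) (basis_bracket a b))"

definition SBMS :: "sbms superalgebra" where
  "SBMS =
     \<lparr>scale = sbms_scale,
      part = (\<lambda>p. {x. \<forall>a\<in>Poly_Mapping.keys x. parity a = p}),
      bracket = sbms_bracket\<rparr>"

section \<open>The modules Omega\<close>

text \<open>
  A polynomial in \<open>\<complex>[t\<^sup>2, s]\<close> is an element of \<^typ>\<open>complex poly poly\<close>: the outer variable is \<open>s\<close>,
  the variable of the coefficients is \<open>t\<^sup>2\<close>. The pair \<open>(f, k)\<close> stands for the element
  \<open>f(t\<^sup>2, s) + t k(t\<^sup>2, s)\<close> of \<open>\<complex>[t\<^sup>2, s] \<oplus> t \<complex>[t\<^sup>2, s]\<close>.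
\<close>

type_synonym poly2 = "complex poly poly"

definition const2 :: "complex \<Rightarrow> poly2" where
  "const2 c = [:[:c:]:]"

definition t2_var :: poly2 where
  "t2_var = [:[:0, 1:]:]"

definition s_var :: poly2 where
  "s_var = [:0, 1:]"

definition shift_s :: "int \<Rightarrow> poly2 \<Rightarrow> poly2" where
  "shift_s m f = pcompose f (s_var - of_int m)"

definition d_t2 :: "poly2 \<Rightarrow> poly2" where
  "d_t2 f = map_poly pderiv f"

text \<open>The division in \<open>h_poly\<close> is exact, since \<open>h(t) - h(\<alpha>)\<close> vanishes at \<open>\<alpha>\<close>.\<close>

definition h_poly :: "complex \<Rightarrow> complex poly \<Rightarrow> int \<Rightarrow> complex poly" where
  "h_poly \<alpha> h m =
     of_int m * h - smult (of_int (m * (m - 1)) * \<alpha>) ((h - [:poly h \<alpha>:]) div [:- \<alpha>, 1:])"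

definition in_t2 :: "complex poly \<Rightarrow> poly2" where
  "in_t2 q = [:q:]"

type_synonym omega = "poly2 \<times> poly2"

definition omega_scale :: "complex \<Rightarrow> omega \<Rightarrow> omega" where
  "omega_scale c v = (smult [:c:] (fst v), smult [:c:] (snd v))"

fun omega_basis_act ::
    "complex \<Rightarrow> complex \<Rightarrow> complex poly \<Rightarrow> sbms_basis \<Rightarrow> omega \<Rightarrow> omega" where
  "omega_basis_act lam \<alpha> h (L m) (f, k) =
     (const2 (lam powi m) * (s_var + in_t2 (h_poly \<alpha> h m)) * shift_s m f
        - of_int m * const2 (lam powi m) * (t2_var - of_int m * const2 \<alpha>) * d_t2 (shift_s m f),
      const2 (lam powi m) * (s_var - const2 (of_int m / 2) + in_t2 (h_poly \<alpha> h m)) * shift_s m k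
        - of_int m * const2 (lam powi m) * (t2_var - of_int m * const2 \<alpha>) * d_t2 (shift_s m k))"
| "omega_basis_act lam \<alpha> h (W m) (f, k) =
     (const2 (lam powi m) * (t2_var - of_int m * const2 \<alpha>) * shift_s m f,
      const2 (lam powi m) * (t2_var - of_int m * const2 \<alpha>) * shift_s m k)"
| "omega_basis_act lam \<alpha> h (G m) (f, k) =
     (const2 (lam powi m) * (t2_var - 2 * of_int m * const2 \<alpha>) * shift_s m k,
      const2 (lam powi m) * shift_s m f)"
| "omega_basis_act lam \<alpha> h C1 (f, k) = 0"
| "omega_basis_act lam \<alpha> h C2 (f, k) = 0"

definition omega_act ::
    "complex \<Rightarrow> complex \<Rightarrow> complex poly \<Rightarrow> sbms \<Rightarrow> omega \<Rightarrow> omega" where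
  "omega_act lam \<alpha> h x v =
     (\<Sum>a\<in>Poly_Mapping.keys x. omega_scale (Poly_Mapping.lookup x a) (omega_basis_act lam \<alpha> h a v))"

definition Omega ::
    "complex \<Rightarrow> complex \<Rightarrow> complex poly \<Rightarrow> (sbms, omega) supermodule" where
  "Omega lam \<alpha> h =
     \<lparr>scale = omega_scale,
      part = (\<lambda>p. if p = 0 then {(f, k). k = 0} else {(f, k). f = 0}),
      act = omega_act lam \<alpha> h\<rparr>"

section \<open>Well-definedness\<close>

text \<open>
  \<open>SBMS\<close> satisfies the Lie superalgebra axioms (\<open>lie_superalgebra_SBMS\<close>) and every \<open>Omega lam \<alpha> h\<close>
  with \<open>lam \<noteq> 0\<close> is a module over it (\<open>is_supermodule_Omega\<close>).
\<close>

lemma lookup_sbms_scale [simp]: "Poly_Mapping.lookup (sbms_scale c x) a = c * Poly_Mapping.lookup x a"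
  by (simp add: sbms_scale_def Poly_Mapping.map.rep_eq when_def)

lemma sbms_scale_simps:
  "sbms_scale c (x + y) = sbms_scale c x + sbms_scale c y"
  "sbms_scale (c + d) x = sbms_scale c x + sbms_scale d x"
  "sbms_scale c (sbms_scale d x) = sbms_scale (c * d) x"
  "sbms_scale 1 x = x"
  "sbms_scale 0 x = 0"
  "sbms_scale c 0 = 0"
  "sbms_scale c (- x) = - sbms_scale c x"
  "sbms_scale c (Poly_Mapping.single a d) = Poly_Mapping.single a (c * d)"
  by (rule poly_mapping_eqI; simp add: Poly_Mapping.lookup_add algebra_simps Poly_Mapping.lookup_single when_def)+

lemma sbms_scale_diff: "sbms_scale c (x - y) = sbms_scale c x - sbms_scale c y"
  by (rule poly_mapping_eqI) (simp add: Poly_Mapping.lookup_minus algebra_simps)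

lemma sbms_scale_sum: "sbms_scale c (sum f A) = (\<Sum>a\<in>A. sbms_scale c (f a))"
  by (induction A rule: infinite_finite_induct) (simp_all add: sbms_scale_simps)

lemma sbms_scale_minus: "sbms_scale (- 1) x = - x"
  by (rule poly_mapping_eqI) simp

lemma vector_space_sbms: "vector_space sbms_scale"
  by unfold_locales (simp_all add: sbms_scale_simps)

lemma omega_scale_simps:
  "omega_scale c (x + y) = omega_scale c x + omega_scale c y"
  "omega_scale (c + d) x = omega_scale c x + omega_scale d x"
  "omega_scale c (omega_scale d x) = omega_scale (c * d) x"
  "omega_scale 1 x = x"
  "omega_scale 0 x = 0"
  "omega_scale c 0 = 0"
  "omega_scale c (- x) = - omega_scale c x"
  by (simp_all add: omega_scale_def prod_eq_iff smult_add_right zero_prod_def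
      mult.commute flip: smult_add_left one_pCons)

lemma vector_space_omega: "vector_space omega_scale"
  by unfold_locales (simp_all add: omega_scale_simps)

text \<open>Linear extension from the basis.\<close>

lemma lin_ext_sum:
  fixes g :: "complex \<Rightarrow> 'a \<Rightarrow> 'b::comm_monoid_add"
  assumes "finite S" "Poly_Mapping.keys x \<subseteq> S" "\<And>a. g 0 a = 0"
  shows "(\<Sum>a\<in>Poly_Mapping.keys x. g (Poly_Mapping.lookup x a) a) = (\<Sum>a\<in>S. g (Poly_Mapping.lookup x a) a)"
  by (rule sum.mono_neutral_left) (use assms in \<open>auto simp: Poly_Mapping.in_keys_iff\<close>)

lemma lin_ext_add:
  fixes g :: "complex \<Rightarrow> 'a \<Rightarrow> 'b::comm_monoid_add"
  assumes "\<And>a. g 0 a = 0" "\<And>c d a. g (c + d) a = g c a + g d a"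
  shows "(\<Sum>a\<in>Poly_Mapping.keys (x + y). g (Poly_Mapping.lookup (x + y) a) a) =
         (\<Sum>a\<in>Poly_Mapping.keys x. g (Poly_Mapping.lookup x a) a) + (\<Sum>a\<in>Poly_Mapping.keys y. g (Poly_Mapping.lookup y a) a)"
proof -
  let ?S = "Poly_Mapping.keys x \<union> Poly_Mapping.keys y"
  have *: "(\<Sum>a\<in>Poly_Mapping.keys z. g (Poly_Mapping.lookup z a) a) =
      (\<Sum>a\<in>?S. g (Poly_Mapping.lookup z a) a)" if "Poly_Mapping.keys z \<subseteq> ?S" for z
    by (rule lin_ext_sum) (use that assms(1) in auto)
  show ?thesis
    unfolding *[OF Poly_Mapping.keys_add] *[of x, OF Un_upper1] *[of y, OF Un_upper2]
    by (simp add: Poly_Mapping.lookup_add assms(2) sum.distrib)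
qed

lemma lin_ext_scale:
  fixes g :: "complex \<Rightarrow> sbms_basis \<Rightarrow> 'b::comm_monoid_add"
  assumes "\<And>a. g 0 a = 0" "\<And>d a. g (c * d) a = s (g d a)" "\<And>u v. s (u + v) = s u + s v" "s 0 = 0"
  shows "(\<Sum>a\<in>Poly_Mapping.keys (sbms_scale c x). g (Poly_Mapping.lookup (sbms_scale c x) a) a) =
         s (\<Sum>a\<in>Poly_Mapping.keys x. g (Poly_Mapping.lookup x a) a)"
proof -
  have "Poly_Mapping.keys (sbms_scale c x) \<subseteq> Poly_Mapping.keys x" by (auto simp: Poly_Mapping.in_keys_iff)
  moreover have "(\<Sum>a\<in>A. s (f a)) = s (sum f A)" for f :: "sbms_basis \<Rightarrow> 'b" and A
    by (induction A rule: infinite_finite_induct) (simp_all add: assms)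
  ultimately show ?thesis
    by (subst lin_ext_sum[where S = "Poly_Mapping.keys x" and g = g])
       (simp_all add: assms(1,2))
qed

lemma sbms_bracket_alt:
  "sbms_bracket x y =
     (\<Sum>a\<in>Poly_Mapping.keys x. sbms_scale (Poly_Mapping.lookup x a) (\<Sum>b\<in>Poly_Mapping.keys y. sbms_scale (Poly_Mapping.lookup y b) (basis_bracket a b)))"
  by (simp add: sbms_bracket_def sbms_scale_sum sbms_scale_simps)

lemma sbms_bracket_alt':
  "sbms_bracket x y =
     (\<Sum>b\<in>Poly_Mapping.keys y. sbms_scale (Poly_Mapping.lookup y b) (\<Sum>a\<in>Poly_Mapping.keys x. sbms_scale (Poly_Mapping.lookup x a) (basis_bracket a b)))"
  unfolding sbms_bracket_def
  by (subst sum.swap) (simp add: sbms_scale_sum sbms_scale_simps mult.commute)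

lemma sbms_bracket_linear:
  "sbms_bracket (x + y) z = sbms_bracket x z + sbms_bracket y z"
  "sbms_bracket z (x + y) = sbms_bracket z x + sbms_bracket z y"
  "sbms_bracket (sbms_scale c x) z = sbms_scale c (sbms_bracket x z)"
  "sbms_bracket z (sbms_scale c x) = sbms_scale c (sbms_bracket z x)"
proof -
  let ?l = "\<lambda>c a. sbms_scale c (\<Sum>b\<in>Poly_Mapping.keys z. sbms_scale (Poly_Mapping.lookup z b) (basis_bracket a b))"
  let ?r = "\<lambda>c b. sbms_scale c (\<Sum>a\<in>Poly_Mapping.keys z. sbms_scale (Poly_Mapping.lookup z a) (basis_bracket a b))"
  show "sbms_bracket (x + y) z = sbms_bracket x z + sbms_bracket y z"
    unfolding sbms_bracket_alt by (rule lin_ext_add[where g = ?l]) (simp_all only: sbms_scale_simps)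
  show "sbms_bracket z (x + y) = sbms_bracket z x + sbms_bracket z y"
    unfolding sbms_bracket_alt' by (rule lin_ext_add[where g = ?r]) (simp_all only: sbms_scale_simps)
  show "sbms_bracket (sbms_scale c x) z = sbms_scale c (sbms_bracket x z)"
    unfolding sbms_bracket_alt
    by (rule lin_ext_scale[where g = ?l and s = "sbms_scale c"]) (simp_all only: sbms_scale_simps)
  show "sbms_bracket z (sbms_scale c x) = sbms_scale c (sbms_bracket z x)"
    unfolding sbms_bracket_alt'
    by (rule lin_ext_scale[where g = ?r and s = "sbms_scale c"]) (simp_all only: sbms_scale_simps)
qed

lemma omega_act_linear:
  "omega_act l \<alpha> h (x + y) v = omega_act l \<alpha> h x v + omega_act l \<alpha> h y v"
  "omega_act l \<alpha> h (sbms_scale c x) v = omega_scale c (omega_act l \<alpha> h x v)"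
  unfolding omega_act_def
  by (rule lin_ext_add[where g = "\<lambda>c a. omega_scale c (omega_basis_act l \<alpha> h a v)"],
      simp_all only: omega_scale_simps)
     (rule lin_ext_scale[where g = "\<lambda>c a. omega_scale c (omega_basis_act l \<alpha> h a v)"
        and s = "omega_scale c"], simp_all only: omega_scale_simps)

lemma linearI':
  assumes "vector_space s1" "vector_space s2"
    "\<And>x y. f (x + y) = f x + f y" "\<And>c x. f (s1 c x) = s2 c (f x)"
  shows "Vector_Spaces.linear s1 s2 f"
  using assms by (simp add: Vector_Spaces.linear_def module_hom_def module_hom_axioms_def
      vector_space_def module_def)

lemma sbms_bracket_zero [simp]: "sbms_bracket 0 y = 0" "sbms_bracket x 0 = 0"
  by (simp_all add: sbms_bracket_def)

lemma sbms_bracket_uminus: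
  "sbms_bracket (- x) y = - sbms_bracket x y" "sbms_bracket x (- y) = - sbms_bracket x y"
  using sbms_bracket_linear(3)[of "- 1" x y] sbms_bracket_linear(4)[of x "- 1" y]
  by (simp_all add: sbms_scale_minus)

lemma sbms_bracket_diff:
  "sbms_bracket (x - z) y = sbms_bracket x y - sbms_bracket z y"
  "sbms_bracket y (x - z) = sbms_bracket y x - sbms_bracket y z"
  using sbms_bracket_linear(1)[of x "- z" y] sbms_bracket_linear(2)[of y x "- z"]
  by (simp_all add: sbms_bracket_uminus)

lemma sbms_bracket_single:
  "sbms_bracket (Poly_Mapping.single a u) (Poly_Mapping.single b v) =
     sbms_scale (u * v) (basis_bracket a b)"
  by (simp add: sbms_bracket_def sbms_scale_simps)

lemma sbms_basis_expand: "x = (\<Sum>a\<in>Poly_Mapping.keys x. sbms_scale (Poly_Mapping.lookup x a) (Poly_Mapping.single a 1))"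
  by (rule poly_mapping_eqI)
     (simp add: Poly_Mapping.lookup_sum Poly_Mapping.lookup_single when_def if_distrib[of "(*) _"] Poly_Mapping.in_keys_iff cong: if_cong)

lemma homogeneous_induct [consumes 1]:
  assumes x: "\<forall>a\<in>Poly_Mapping.keys x. parity a = p"
    and "P 0" "\<And>u v. P u \<Longrightarrow> P v \<Longrightarrow> P (u + v)" "\<And>c u. P u \<Longrightarrow> P (sbms_scale c u)"
    and single: "\<And>a. parity a = p \<Longrightarrow> P (Poly_Mapping.single a 1)"
  shows "P x"
proof -
  have "P (\<Sum>a\<in>A. sbms_scale (f a) (Poly_Mapping.single a 1))"
    if "finite A" "\<forall>a\<in>A. parity a = p" for A f
    using that by induction (auto intro!: assms)
  from this[of "Poly_Mapping.keys x" "Poly_Mapping.lookup x"] show ?thesis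
    using x by (simp flip: sbms_basis_expand)
qed

lemma sbms_induct:
  assumes "P 0" "\<And>u v. P u \<Longrightarrow> P v \<Longrightarrow> P (u + v)" "\<And>c u. P u \<Longrightarrow> P (sbms_scale c u)"
    and single: "\<And>a. P (Poly_Mapping.single a 1)"
  shows "P (x :: sbms)"
proof -
  have "P (\<Sum>a\<in>A. sbms_scale (f a) (Poly_Mapping.single a 1))"
    if "finite A" for A f
    using that by induction (auto intro!: assms)
  from this[of "Poly_Mapping.keys x" "Poly_Mapping.lookup x"] show ?thesis
    by (simp flip: sbms_basis_expand)
qed


lemma bracket_central [simp]:
  "sbms_bracket (Poly_Mapping.single a u) (central c k C1) = 0"
  "sbms_bracket (Poly_Mapping.single a u) (central c k C2) = 0"
  "sbms_bracket (central c k C1) (Poly_Mapping.single a u) = 0"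
  "sbms_bracket (central c k C2) (Poly_Mapping.single a u) = 0"
  by (cases a; simp add: central_def sbms_bracket_single sbms_scale_simps)+

lemma scale_central [simp]:
  "sbms_scale d (central c k z) = central (d * c) k z"
  by (simp add: central_def sbms_scale_simps)

lemma lookup_central: "Poly_Mapping.lookup (central c k z) j = (if k = 0 \<and> j = z then c else 0)"
  by (simp add: central_def Poly_Mapping.lookup_single when_def)

lemma basis_antisym:
  "basis_bracket a b = - sbms_scale (koszul_sign (parity a) (parity b)) (basis_bracket b a)"
  apply (cases a; cases b; hypsubst)
  apply (simp_all add: sbms_scale_simps koszul_sign_def sbms_scale_minus add.commute del: Poly_Mapping.single_of_int)
  apply (rule_tac [!] poly_mapping_eqI)
  apply (auto simp: Poly_Mapping.lookup_add Poly_Mapping.lookup_minus Poly_Mapping.lookup_single lookup_central when_def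
    add.assoc add.left_commute)
  apply (simp_all only: add_eq_0_iff2)
  apply (simp_all (no_asm) add: field_simps power3_eq_cube power2_eq_square)
  done

lemma basis_jacobi:
  "sbms_bracket (Poly_Mapping.single a 1) (basis_bracket b c) =
     sbms_bracket (basis_bracket a b) (Poly_Mapping.single c 1) +
     sbms_scale (koszul_sign (parity a) (parity b))
       (sbms_bracket (Poly_Mapping.single b 1) (basis_bracket a c))"
  apply (cases a; cases b; cases c; hypsubst)
  apply (simp_all add: sbms_bracket_linear sbms_bracket_uminus sbms_bracket_diff sbms_scale_diff sbms_bracket_single sbms_scale_minus
        sbms_scale_simps koszul_sign_def del: Poly_Mapping.single_of_int)
  apply (rule_tac [!] poly_mapping_eqI)
  apply (auto simp: Poly_Mapping.lookup_add Poly_Mapping.lookup_minus Poly_Mapping.lookup_single lookup_central when_def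
    add.assoc add.left_commute)
  apply (simp_all only: add_eq_0_iff2)
  apply (simp_all (no_asm) add: field_simps power3_eq_cube power2_eq_square)
  done

lemma linearD:
  assumes "Vector_Spaces.linear s1 s2 f"
  shows "f (x + y) = f x + f y" "f (s1 c x) = s2 c (f x)" "f 0 = 0"
proof -
  interpret Vector_Spaces.linear s1 s2 f by fact
  show "f (x + y) = f x + f y" "f (s1 c x) = s2 c (f x)" "f 0 = 0"
    by (simp_all add: add scale zero)
qed

lemma SBMS_simps [simp]: "scale SBMS = sbms_scale" "bracket SBMS = sbms_bracket"
  by (simp_all add: SBMS_def)

lemma SBMS_part: "x \<in> part SBMS p \<longleftrightarrow> (\<forall>a\<in>Poly_Mapping.keys x. parity a = p)"
  by (simp add: SBMS_def)

lemma part_SBMS_closed: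
  "0 \<in> part SBMS p" "x \<in> part SBMS p \<Longrightarrow> y \<in> part SBMS p \<Longrightarrow> x + y \<in> part SBMS p"
  "x \<in> part SBMS p \<Longrightarrow> sbms_scale c x \<in> part SBMS p"
  using Poly_Mapping.keys_add[of x y] by (auto simp: SBMS_part Poly_Mapping.in_keys_iff)

lemma part_SBMS_uminus: "x \<in> part SBMS p \<Longrightarrow> - x \<in> part SBMS p"
  using part_SBMS_closed(3)[of x p "- 1"] by (simp add: sbms_scale_minus)

lemma part_SBMS_basis:
  "parity a = p \<Longrightarrow> Poly_Mapping.single a c \<in> part SBMS p"
  "parity a = p \<Longrightarrow> central c k a \<in> part SBMS p"
  by (simp_all add: SBMS_part central_def)

lemma basis_bracket_part: "basis_bracket a b \<in> part SBMS (parity a + parity b)"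
  by (cases a; cases b)
     (simp_all only: basis_bracket.simps parity.simps add_0_left add_0_right,
      (intro part_SBMS_closed(1,2) part_SBMS_uminus part_SBMS_basis; simp)+)

lemma super_vector_space_SBMS: "super_vector_space SBMS"
proof -
  interpret vector_space sbms_scale by (rule vector_space_sbms)
  have "\<exists>u\<in>part SBMS 0. \<exists>v\<in>part SBMS 1. x = u + v" for x
  proof (induction x rule: sbms_induct)
    case 1
    show ?case by (rule bexI[of _ 0], rule bexI[of _ 0]) (simp_all add: SBMS_def)
  next
    case (2 x y)
    then obtain u v u' v' where *: "u \<in> part SBMS 0" "v \<in> part SBMS 1" "u' \<in> part SBMS 0"
      "v' \<in> part SBMS 1" "x = u + v" "y = u' + v'" by blast
    have "x + y = (u + u') + (v + v')" using * by (simp add: add_ac)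
    then show ?case
      using * part_SBMS_closed(2) by blast
  next
    case (3 c x)
    then obtain u v where *: "u \<in> part SBMS 0" "v \<in> part SBMS 1" "x = u + v" by blast
    then have "sbms_scale c x = sbms_scale c u + sbms_scale c v" by (simp add: sbms_scale_simps)
    then show ?case
      using * part_SBMS_closed(3) by blast
  next
    case (4 a)
    show ?case
    proof (cases "parity a = 0")
      case True
      then show ?thesis
        by (intro bexI[of _ "Poly_Mapping.single a 1"] bexI[of _ 0]) (simp_all add: SBMS_def)
    next
      case False
      then show ?thesis
        by (intro bexI[of _ 0] bexI[of _ "Poly_Mapping.single a 1"]) (simp_all add: SBMS_def)
    qed
  qed
  moreover have "subspace (part SBMS p)" for p
    by (rule subspaceI) (rule part_SBMS_closed; assumption)+
  moreover have "part SBMS 0 \<inter> part SBMS 1 = {0}"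
    by (auto simp: SBMS_def simp flip: Poly_Mapping.keys_eq_empty)
  ultimately show ?thesis
    by (simp add: super_vector_space_def vector_space_sbms)
qed

lemma sbms_bracket_part:
  assumes "x \<in> part SBMS p" "y \<in> part SBMS q"
  shows "sbms_bracket x y \<in> part SBMS (p + q)"
  using assms(1)[unfolded SBMS_part]
proof (induction rule: homogeneous_induct)
  case (4 a)
  show ?case
    using assms(2)[unfolded SBMS_part]
  proof (induction rule: homogeneous_induct)
    case (4 b)
    with \<open>parity a = p\<close> show ?case
      using basis_bracket_part[of a b] by (simp add: sbms_bracket_single sbms_scale_simps)
  qed (simp_all add: sbms_bracket_linear part_SBMS_closed)
qed (simp_all add: sbms_bracket_linear part_SBMS_closed)

lemma sbms_antisym:
  assumes "x \<in> part SBMS p" "y \<in> part SBMS q"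
  shows "sbms_bracket x y = - sbms_scale (koszul_sign p q) (sbms_bracket y x)"
  using assms(1)[unfolded SBMS_part]
proof (induction rule: homogeneous_induct)
  case (4 a)
  show ?case
    using assms(2)[unfolded SBMS_part]
  proof (induction rule: homogeneous_induct)
    case (4 b)
    with \<open>parity a = p\<close> show ?case
      using basis_antisym[of a b] by (simp add: sbms_bracket_single sbms_scale_simps)
  qed (simp_all add: sbms_bracket_linear sbms_scale_simps mult.commute)
qed (simp_all add: sbms_bracket_linear sbms_scale_simps mult.commute)

lemma sbms_jacobi:
  assumes "x \<in> part SBMS p" "y \<in> part SBMS q"
  shows "sbms_bracket x (sbms_bracket y z) = sbms_bracket (sbms_bracket x y) z +
           sbms_scale (koszul_sign p q) (sbms_bracket y (sbms_bracket x z))"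
  using assms(1)[unfolded SBMS_part]
proof (induction rule: homogeneous_induct)
  case (4 a)
  show ?case
    using assms(2)[unfolded SBMS_part]
  proof (induction rule: homogeneous_induct)
    case (4 b)
    show ?case
    proof (induction z rule: sbms_induct)
      case (4 c)
      with \<open>parity a = p\<close> \<open>parity b = q\<close> show ?case
        using basis_jacobi[of a b c] by (simp add: sbms_bracket_single sbms_scale_simps)
    qed (simp_all add: sbms_bracket_linear sbms_scale_simps mult.commute)
  qed (simp_all add: sbms_bracket_linear sbms_scale_simps mult.commute)
qed (simp_all add: sbms_bracket_linear sbms_scale_simps mult.commute)

lemma lie_superalgebra_SBMS: "lie_superalgebra SBMS"
  unfolding lie_superalgebra_def SBMS_simps
  by (intro conjI allI ballI super_vector_space_SBMS linearI' vector_space_sbms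
      sbms_bracket_linear sbms_bracket_part sbms_antisym sbms_jacobi)

lemma shift_s_simps:
  "shift_s m (f + g) = shift_s m f + shift_s m g"
  "shift_s m (f - g) = shift_s m f - shift_s m g"
  "shift_s m (f * g) = shift_s m f * shift_s m g"
  "shift_s m s_var = s_var - of_int m"
  "shift_s m t2_var = t2_var"
  "shift_s m (const2 c) = const2 c"
  "shift_s m (in_t2 q) = in_t2 q"
  "shift_s m (of_int k) = of_int k"
  "shift_s m (numeral w) = numeral w"
  "shift_s m 1 = 1"
  "shift_s m 0 = 0"
proof -
  have c: "pcompose [:a:] r = [:a:]" for a :: "complex poly" and r by simp
  show "shift_s m (of_int k) = of_int k" "shift_s m (numeral w) = numeral w"
    by (simp_all add: shift_s_def of_int_poly numeral_poly)
qed (simp_all add: shift_s_def pcompose_add pcompose_diff pcompose_mult s_var_def t2_var_def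
      const2_def in_t2_def pcompose_pCons pcompose_1)

lemma shift_s_shift_s: "shift_s m (shift_s n f) = shift_s (m + n) f"
  unfolding shift_s_def pcompose_assoc[symmetric]
  by (simp add: pcompose_diff s_var_def pcompose_pCons of_int_poly minus_diff_commute)

lemma d_t2_pCons: "d_t2 (pCons a f) = pCons (pderiv a) (d_t2 f)"
  by (simp add: d_t2_def map_poly_pCons)

lemma d_t2_add: "d_t2 (f + g) = d_t2 f + d_t2 g"
  by (rule poly_eqI) (simp add: d_t2_def coeff_map_poly pderiv_add)

lemma d_t2_diff: "d_t2 (f - g) = d_t2 f - d_t2 g"
  by (rule poly_eqI) (simp add: d_t2_def coeff_map_poly pderiv_diff)

lemma d_t2_smult: "d_t2 (smult a f) = smult a (d_t2 f) + smult (pderiv a) f"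
  by (rule poly_eqI) (simp add: d_t2_def coeff_map_poly pderiv_mult algebra_simps)

lemma d_t2_mult: "d_t2 (f * g) = d_t2 f * g + f * d_t2 g"
proof (induction f)
  case (pCons a f)
  then show ?case
    by (simp add: mult_pCons_left d_t2_add d_t2_smult d_t2_pCons algebra_simps)
qed (simp add: d_t2_def)

lemma d_t2_simps:
  "d_t2 s_var = 0" "d_t2 t2_var = 1" "d_t2 (const2 c) = 0" "d_t2 (in_t2 q) = in_t2 (pderiv q)"
  "d_t2 (of_int k) = 0" "d_t2 (numeral w) = 0" "d_t2 1 = 0" "d_t2 0 = 0"
proof -
  show "d_t2 (of_int k) = 0" "d_t2 (numeral w) = 0"
    by (simp_all add: of_int_poly numeral_poly d_t2_def map_poly_pCons)
qed (simp_all add: s_var_def t2_var_def const2_def in_t2_def d_t2_def map_poly_pCons pderiv_pCons one_pCons)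

lemma d_t2_shift_s: "d_t2 (shift_s m f) = shift_s m (d_t2 f)"
proof (induction f)
  case 0
  show ?case by (simp add: d_t2_def shift_s_def)
next
  case (pCons a f)
  have *: "shift_s m (pCons b g) = in_t2 b + (s_var - of_int m) * shift_s m g" for b g
    by (simp add: shift_s_def pcompose_pCons in_t2_def)
  show ?case
    by (simp add: * d_t2_pCons d_t2_add d_t2_mult d_t2_diff d_t2_simps pCons.IH)
qed

lemma in_t2_simps:
  "in_t2 (p + q) = in_t2 p + in_t2 q"
  "in_t2 (p - q) = in_t2 p - in_t2 q"
  "in_t2 (p * q) = in_t2 p * in_t2 q"
  "in_t2 (of_int k) = of_int k"
  "in_t2 (smult c q) = const2 c * in_t2 q"
  "in_t2 [:c:] = const2 c"
  "in_t2 [:0, 1:] = t2_var"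
  by (simp_all add: in_t2_def const2_def t2_var_def of_int_poly mult.commute)

lemma const2_simps:
  "const2 (a + b) = const2 a + const2 b"
  "const2 (a - b) = const2 a - const2 b"
  "const2 (- a) = - const2 a"
  "const2 (a * b) = const2 a * const2 b"
  "const2 (of_int k) = of_int k"
  "const2 (numeral w) = numeral w"
  "const2 0 = 0"
  "const2 1 = 1"
  by (simp_all add: const2_def of_int_poly numeral_poly one_pCons)

lemma omega_scale_const2: "omega_scale c (f, k) = (const2 c * f, const2 c * k)"
  by (simp add: omega_scale_def const2_def)

lemma h_poly_alt:
  obtains q where
    "\<And>m. in_t2 (h_poly \<alpha> h m) =
       of_int m * in_t2 h - of_int m * (of_int m - 1) * const2 \<alpha> * in_t2 q"
    "in_t2 (pderiv h) = in_t2 q + (t2_var - const2 \<alpha>) * in_t2 (pderiv q)"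
proof
  let ?q = "(h - [:poly h \<alpha>:]) div [:- \<alpha>, 1:]"
  show "in_t2 (h_poly \<alpha> h m) =
       of_int m * in_t2 h - of_int m * (of_int m - 1) * const2 \<alpha> * in_t2 ?q" for m
    by (simp add: h_poly_def in_t2_simps const2_simps algebra_simps)
  have "[:- \<alpha>, 1:] dvd h - [:poly h \<alpha>:]"
    by (simp flip: poly_eq_0_iff_dvd)
  then have "h - [:poly h \<alpha>:] = [:- \<alpha>, 1:] * ?q"
    by (rule dvd_mult_div_cancel[symmetric])
  moreover have "[:- \<alpha>, 1:] = [:0, 1:] - [:\<alpha>:]" by simp
  ultimately have "h = [:poly h \<alpha>:] + ([:0, 1:] - [:\<alpha>:]) * ?q"
    by (simp only: diff_eq_eq add.commute)
  then have "pderiv h = pderiv ([:poly h \<alpha>:] + ([:0, 1:] - [:\<alpha>:]) * ?q)"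
    by (rule arg_cong)
  also have "\<dots> = ?q + ([:0, 1:] - [:\<alpha>:]) * pderiv ?q"
    by (simp add: pderiv_add pderiv_mult pderiv_pCons pderiv_diff pderiv_smult)
  finally show "in_t2 (pderiv h) = in_t2 ?q + (t2_var - const2 \<alpha>) * in_t2 (pderiv ?q)"
    by (simp only: in_t2_simps)
qed

lemma const2_half: "const2 (of_int m / 2) = of_int m * const2 (1 / 2)"
  by (simp flip: const2_simps(4,5))

lemma const2_half_twice: "2 * const2 (1 / 2) = 1"
  by (simp flip: const2_simps(4,6) const2_simps(8))

lemma omega_act_simps:
  "omega_act lam \<alpha> h (Poly_Mapping.single a u) v = omega_scale u (omega_basis_act lam \<alpha> h a v)"
  "omega_act lam \<alpha> h 0 v = 0"
  by (simp_all add: omega_act_def omega_scale_simps)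

lemma omega_act_uminus: "omega_act lam \<alpha> h (- x) v = - omega_act lam \<alpha> h x v"
  using omega_act_linear(1)[of lam \<alpha> h x "- x" v] by (simp add: omega_act_simps eq_neg_iff_add_eq_0 add.commute)

lemma omega_act_diff:
  "omega_act lam \<alpha> h (x - y) v = omega_act lam \<alpha> h x v - omega_act lam \<alpha> h y v"
  using omega_act_linear(1)[of lam \<alpha> h x "- y" v] by (simp add: omega_act_uminus)

lemma omega_act_central:
  "omega_act lam \<alpha> h (central c k C1) v = 0" "omega_act lam \<alpha> h (central c k C2) v = 0"
  by (cases v; simp add: central_def omega_act_simps omega_scale_simps)+

lemma omega_basis_act_linear:
  "omega_basis_act lam \<alpha> h a (v + w) = omega_basis_act lam \<alpha> h a v + omega_basis_act lam \<alpha> h a w"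
  "omega_basis_act lam \<alpha> h a (omega_scale c v) = omega_scale c (omega_basis_act lam \<alpha> h a v)"
  by (cases v; cases w; cases a;
      simp add: omega_scale_const2 shift_s_simps d_t2_add d_t2_mult d_t2_simps zero_prod_def algebra_simps)+

lemma omega_basis_act_zero: "omega_basis_act lam \<alpha> h a 0 = 0"
  using omega_basis_act_linear(2)[of lam \<alpha> h a 0 0] by (simp add: omega_scale_simps)

lemma omega_act_zero: "omega_act lam \<alpha> h x 0 = 0"
  by (simp add: omega_act_def omega_basis_act_zero omega_scale_simps)

lemma of_int_half: "(of_int m :: poly2) = 2 * const2 (of_int m / 2)"
  unfolding const2_half using const2_half_twice by (simp add: mult.left_commute)

lemma basis_module:
  assumes "lam \<noteq> 0"
  shows "omega_basis_act lam \<alpha> h a (omega_basis_act lam \<alpha> h b v)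
       - omega_scale (koszul_sign (parity a) (parity b))
           (omega_basis_act lam \<alpha> h b (omega_basis_act lam \<alpha> h a v))
       = omega_act lam \<alpha> h (basis_bracket a b) v"
proof -
  obtain f k where v: "v = (f, k)" by (cases v)
  obtain q where q:
    "\<And>m. in_t2 (h_poly \<alpha> h m) =
       of_int m * in_t2 h - of_int m * (of_int m - 1) * const2 \<alpha> * in_t2 q"
    "in_t2 (pderiv h) = in_t2 q + (t2_var - const2 \<alpha>) * in_t2 (pderiv q)"
    using h_poly_alt[of \<alpha> h] by blast
  note [simp] = koszul_sign_def omega_act_linear(1) omega_act_simps omega_act_uminus omega_act_diff omega_act_central
    power_int_add[OF disjI1, OF assms] const2_simps q in_t2_simps shift_s_simps shift_s_shift_s
    d_t2_shift_s d_t2_mult d_t2_add d_t2_diff d_t2_simps omega_scale_const2 v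
    add.commute[of "_ :: int"] zero_prod_def add_divide_distrib diff_divide_distrib
  show ?thesis
    apply (cases a; cases b)
    apply (simp_all del: of_int_add of_int_diff)
    apply (simp_all add: of_int_half)
    apply (simp_all add: algebra_simps)
    done
qed


lemma Omega_simps [simp]:
  "scale (Omega lam \<alpha> h) = omega_scale" "act (Omega lam \<alpha> h) = omega_act lam \<alpha> h"
  by (simp_all add: Omega_def)

lemma Omega_part:
  "v \<in> part (Omega lam \<alpha> h) p \<longleftrightarrow> (if p = 0 then snd v = 0 else fst v = 0)"
  by (cases v) (simp add: Omega_def)

lemma part_Omega_closed:
  "0 \<in> part (Omega lam \<alpha> h) p"
  "v \<in> part (Omega lam \<alpha> h) p \<Longrightarrow> w \<in> part (Omega lam \<alpha> h) p \<Longrightarrow> v + w \<in> part (Omega lam \<alpha> h) p"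
  "v \<in> part (Omega lam \<alpha> h) p \<Longrightarrow> omega_scale c v \<in> part (Omega lam \<alpha> h) p"
  by (auto simp: Omega_part omega_scale_def split: if_splits)

lemma super_vector_space_Omega: "super_vector_space (Omega lam \<alpha> h)"
proof -
  interpret vector_space omega_scale by (rule vector_space_omega)
  have "subspace (part (Omega lam \<alpha> h) p)" for p
    by (rule subspaceI) (rule part_Omega_closed; assumption)+
  moreover have "part (Omega lam \<alpha> h) 0 \<inter> part (Omega lam \<alpha> h) 1 = {0}"
    by (auto simp: Omega_part prod_eq_iff)
  moreover have "\<exists>a\<in>part (Omega lam \<alpha> h) 0. \<exists>b\<in>part (Omega lam \<alpha> h) 1. v = a + b" for v
    by (rule bexI[of _ "(fst v, 0)"], rule bexI[of _ "(0, snd v)"])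
       (simp_all add: Omega_part prod_eq_iff)
  ultimately show ?thesis
    by (simp add: super_vector_space_def vector_space_omega)
qed

lemma omega_act_part:
  assumes "x \<in> part SBMS p" "v \<in> part (Omega lam \<alpha> h) q"
  shows "omega_act lam \<alpha> h x v \<in> part (Omega lam \<alpha> h) (p + q)"
  using assms(1)[unfolded SBMS_part]
proof (induction rule: homogeneous_induct)
  case (4 a)
  show ?case
    using 4 assms(2)
    by (cases v; cases a)
       (auto simp: omega_act_simps omega_scale_const2 Omega_part shift_s_simps d_t2_simps
          const2_simps omega_scale_simps split: if_splits)
qed (simp_all add: omega_act_linear omega_act_simps part_Omega_closed)

lemma omega_act_linear2:
  "omega_act lam \<alpha> h x (v + w) = omega_act lam \<alpha> h x v + omega_act lam \<alpha> h x w"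
  "omega_act lam \<alpha> h x (omega_scale c v) = omega_scale c (omega_act lam \<alpha> h x v)"
  by (induction x rule: sbms_induct)
     (simp_all add: omega_act_simps omega_act_linear omega_scale_simps omega_basis_act_linear
        mult.commute)

lemma omega_module:
  assumes "lam \<noteq> 0" "x \<in> part SBMS p" "y \<in> part SBMS q"
  shows "omega_act lam \<alpha> h x (omega_act lam \<alpha> h y v)
       - omega_scale (koszul_sign p q) (omega_act lam \<alpha> h y (omega_act lam \<alpha> h x v))
       = omega_act lam \<alpha> h (sbms_bracket x y) v"
  using assms(2)[unfolded SBMS_part]
proof (induction rule: homogeneous_induct)
  case (4 a)
  show ?case
    using assms(3)[unfolded SBMS_part]
  proof (induction rule: homogeneous_induct)
    case (4 b)
    with \<open>parity a = p\<close> show ?case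
      using basis_module[OF assms(1), of \<alpha> h a b v]
      by (simp add: omega_act_simps omega_scale_simps sbms_bracket_single sbms_scale_simps)
  qed (simp_all add: omega_act_linear omega_act_linear2 sbms_bracket_linear omega_scale_simps
         omega_act_simps omega_act_zero omega_basis_act_zero mult.commute algebra_simps)
qed (simp_all add: omega_act_linear omega_act_linear2 sbms_bracket_linear omega_scale_simps
       omega_act_simps omega_act_zero omega_basis_act_zero mult.commute algebra_simps)

theorem is_supermodule_Omega:
  assumes "lam \<noteq> 0"
  shows "is_supermodule SBMS (Omega lam \<alpha> h)"
  unfolding is_supermodule_def SBMS_simps Omega_simps
  by (intro conjI allI ballI super_vector_space_Omega linearI' vector_space_sbms vector_space_omega
      omega_act_linear omega_act_linear2 omega_act_part omega_module assms)

end

theory Submission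
  imports Defs
begin

text \<open>
  The element \<open>L 0\<close> acts as multiplication by \<open>s\<close> and \<open>W 0\<close> as multiplication by \<open>t\<^sup>2\<close>, independently
  of the parameters. A homomorphism between two of these modules is therefore linear over
  \<open>\<complex>[t\<^sup>2, s]\<close> (\<open>intertwiner_poly_scale\<close>), and both modules are free of rank \<open>1 | 1\<close> over this ring, with
  basis \<open>1, t\<close>. As \<open>G 0\<close> sends \<open>1\<close> to \<open>t\<close> and \<open>t\<close> to \<open>t\<^sup>2\<close>, the homomorphism is determined by the
  image of \<open>1\<close>.

  An isomorphism from the parity change is an odd homomorphism between the original modules. If the
  homomorphism is odd, say \<open>1 \<mapsto> t d\<close>, then applying \<open>G 0\<close> gives \<open>t \<mapsto> t\<^sup>2 d\<close>. The even part of
  the image then lies in the ideal generated by \<open>t\<^sup>2\<close> and misses \<open>1\<close>, so it is not surjective.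

  If the homomorphism is even, then \<open>1 \<mapsto> e\<close>, and surjectivity makes \<open>e\<close> a unit of \<open>\<complex>[t\<^sup>2, s]\<close>, that
  is, a nonzero constant. Constants are fixed by the shifts in \<open>s\<close> and killed by the derivative in
  \<open>t\<^sup>2\<close>, so the elements \<open>W 1\<close> and \<open>L 1\<close> applied to \<open>1\<close> are the same in both modules. The former is
  \<open>\<lambda> (t\<^sup>2 - \<alpha>)\<close>, which determines \<open>\<lambda>\<close> and \<open>\<alpha>\<close>; the latter is \<open>\<lambda> (s + h(t\<^sup>2))\<close>, which then
  determines \<open>h\<close>.
\<close>

definition poly_scale :: "poly2 \<Rightarrow> omega \<Rightarrow> omega" where
  "poly_scale q v = (q * fst v, q * snd v)"

lemma L0_act: "omega_basis_act lam \<alpha> h (L 0) v = poly_scale s_var v"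
  by (cases v) (simp add: poly_scale_def h_poly_def in_t2_def const2_simps shift_s_def s_var_def)

lemma W0_act: "omega_basis_act lam \<alpha> h (W 0) v = poly_scale t2_var v"
  by (cases v) (simp add: poly_scale_def const2_simps shift_s_def s_var_def)

lemma G0_act: "omega_basis_act lam \<alpha> h (G 0) v = (t2_var * snd v, fst v)"
  by (cases v) (simp add: const2_simps shift_s_def s_var_def)

lemma poly_scale_simps:
  "poly_scale (p + q) v = poly_scale p v + poly_scale q v"
  "poly_scale (p * q) v = poly_scale p (poly_scale q v)"
  "poly_scale 0 v = 0"
  "poly_scale (const2 c) v = omega_scale c v"
  by (simp_all add: poly_scale_def omega_scale_def const2_def algebra_simps zero_prod_def)

lemma in_t2_pCons: "in_t2 (pCons c p) = const2 c + t2_var * in_t2 p"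
  by (simp add: in_t2_def const2_def t2_var_def)

lemma poly2_pCons: "(pCons p q :: poly2) = in_t2 p + s_var * q"
  by (simp add: in_t2_def s_var_def)

text \<open>
  \<open>\<complex>[t\<^sup>2, s]\<close> is generated as an algebra by \<open>t\<^sup>2\<close> and \<open>s\<close>, so commuting with these two suffices for
  linearity over the whole ring.
\<close>

lemma poly_scale_commute:
  assumes add: "\<And>v w. \<phi> (v + w) = \<phi> v + \<phi> w"
    and scale: "\<And>c v. \<phi> (omega_scale c v) = omega_scale c (\<phi> v)"
    and t2: "\<And>v. \<phi> (poly_scale t2_var v) = poly_scale t2_var (\<phi> v)"
    and s: "\<And>v. \<phi> (poly_scale s_var v) = poly_scale s_var (\<phi> v)"
  shows "\<phi> (poly_scale q v) = poly_scale q (\<phi> v)"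
proof -
  have zero: "\<phi> 0 = 0"
    using add[of 0 0] by simp
  have coeff: "\<phi> (poly_scale (in_t2 p) v) = poly_scale (in_t2 p) (\<phi> v)" for p v
  proof (induction p)
    case 0
    have "in_t2 0 = 0" by (simp add: in_t2_def)
    then show ?case by (simp add: poly_scale_simps zero)
  next
    case (pCons c p)
    then show ?case by (simp add: in_t2_pCons poly_scale_simps add scale t2)
  qed
  show ?thesis
    by (induction q) (simp_all add: poly2_pCons poly_scale_simps zero add s coeff)
qed

definition intertwiner :: "complex \<Rightarrow> complex \<Rightarrow> complex poly \<Rightarrow> complex \<Rightarrow> complex \<Rightarrow> complex poly \<Rightarrow>
    (omega \<Rightarrow> omega) \<Rightarrow> bool" where
  "intertwiner lam \<alpha> h \<mu> \<beta> g \<phi> \<longleftrightarrow>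
     Vector_Spaces.linear omega_scale omega_scale \<phi> \<and>
     (\<forall>x v. \<phi> (omega_act lam \<alpha> h x v) = omega_act \<mu> \<beta> g x (\<phi> v))"

lemma intertwiner_basis:
  assumes "intertwiner lam \<alpha> h \<mu> \<beta> g \<phi>"
  shows "\<phi> (omega_basis_act lam \<alpha> h a v) = omega_basis_act \<mu> \<beta> g a (\<phi> v)"
proof -
  have "\<phi> (omega_act lam \<alpha> h (Poly_Mapping.single a 1) v) =
      omega_act \<mu> \<beta> g (Poly_Mapping.single a 1) (\<phi> v)"
    using assms unfolding intertwiner_def by blast
  then show ?thesis
    by (simp only: omega_act_simps omega_scale_simps)
qed

lemma intertwiner_linear:
  assumes "intertwiner lam \<alpha> h \<mu> \<beta> g \<phi>"
  shows "\<phi> (v + w) = \<phi> v + \<phi> w" "\<phi> (omega_scale c v) = omega_scale c (\<phi> v)"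
  using assms unfolding intertwiner_def Vector_Spaces.linear_iff by blast+

lemma intertwiner_poly_scale:
  assumes "intertwiner lam \<alpha> h \<mu> \<beta> g \<phi>"
  shows "\<phi> (poly_scale q v) = poly_scale q (\<phi> v)"
proof (rule poly_scale_commute)
  show "\<phi> (v + w) = \<phi> v + \<phi> w" for v w
    by (rule intertwiner_linear(1)[OF assms])
  show "\<phi> (omega_scale c v) = omega_scale c (\<phi> v)" for c v
    by (rule intertwiner_linear(2)[OF assms])
  show "\<phi> (poly_scale t2_var v) = poly_scale t2_var (\<phi> v)" for v
    using intertwiner_basis[OF assms, of "W 0" v] by (simp add: W0_act)
  show "\<phi> (poly_scale s_var v) = poly_scale s_var (\<phi> v)" for v
    using intertwiner_basis[OF assms, of "L 0" v] by (simp add: L0_act)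
qed

text \<open>
  In terms of the action, \<open>f + t k\<close> is \<open>f \<cdot> 1 + k \<cdot> G 0 1\<close>, whence the formula for a homomorphism in terms of the
  image \<open>(e, d)\<close> of \<open>1\<close>.
\<close>

lemma intertwiner_generator:
  assumes "intertwiner lam \<alpha> h \<mu> \<beta> g \<phi>" "\<phi> (1, 0) = (e, d)"
  shows "\<phi> (f, k) = (f * e + k * (t2_var * d), f * d + k * e)"
proof -
  have "\<phi> (0, 1) = (t2_var * d, e)"
    using intertwiner_basis[OF assms(1), of "G 0" "(1, 0)"] assms(2)
    by (simp only: G0_act fst_conv snd_conv mult_zero_right)
  moreover have "(f, k) = poly_scale f (1, 0) + poly_scale k (0, 1)"
    by (simp add: poly_scale_def)
  ultimately show ?thesis
    by (simp add: intertwiner_linear(1)[OF assms(1)] intertwiner_poly_scale[OF assms(1)] assms(2))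
      (simp add: poly_scale_def)
qed

lemma t2_var_not_unit: "\<not> t2_var dvd 1"
  by (auto simp: t2_var_def is_unit_poly_iff)

text \<open>
  An odd map sends \<open>1\<close> to \<open>t d\<close>, so by the formula above the even component of every value is a
  multiple of \<open>t\<^sup>2\<close>, and \<open>1\<close> is not attained.
\<close>

lemma not_surj_odd_intertwiner:
  assumes "intertwiner lam \<alpha> h \<mu> \<beta> g \<phi>" "fst (\<phi> (1, 0)) = 0"
  shows "\<not> surj \<phi>"
proof
  assume "surj \<phi>"
  then obtain f k where fk: "\<phi> (f, k) = (1, 0)"
    by (metis surjD surj_pair)
  obtain d where "\<phi> (1, 0) = (0, d)"
    using assms(2) by (metis prod.collapse)
  from intertwiner_generator[OF assms(1) this, of f k] fk
  have "1 = t2_var * (k * d)" by (simp add: mult_ac)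
  then show False
    using t2_var_not_unit dvdI by blast
qed

text \<open>
  An even map is multiplication by the image \<open>e\<close> of \<open>1\<close>. A preimage of \<open>1\<close> provides an inverse of
  \<open>e\<close>, and the units of a polynomial ring over a field are the nonzero constants.
\<close>

lemma surj_even_intertwiner_generator:
  assumes "intertwiner lam \<alpha> h \<mu> \<beta> g \<phi>" "snd (\<phi> (1, 0)) = 0" "surj \<phi>"
  obtains c where "c \<noteq> 0" "\<phi> (1, 0) = (const2 c, 0)"
proof -
  obtain f k where fk: "\<phi> (f, k) = (1, 0)"
    using assms(3) by (metis surjD surj_pair)
  obtain e where e: "\<phi> (1, 0) = (e, 0)"
    using assms(2) by (metis prod.collapse)
  from intertwiner_generator[OF assms(1) e, of f k] fk have "1 = e * f"
    by (simp add: mult.commute)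
  then have "e dvd 1" by (rule dvdI)
  then obtain c where "c \<noteq> 0" "e = const2 c"
    by (auto simp: is_unit_poly_iff const2_def dvd_field_iff)
  with e that show thesis by blast
qed

text \<open>
  On a constant the shift in \<open>s\<close> and the derivative in \<open>t\<^sup>2\<close> are invisible, so the index \<open>1\<close> exposes
  the parameters: the correction term of \<open>h_poly \<alpha> h m\<close> carries the factor \<open>m - 1\<close> and vanishes.
\<close>

lemma W1_act_one: "omega_basis_act lam \<alpha> h (W 1) (const2 c, 0) =
    poly_scale (const2 c) ([:[:- lam * \<alpha>, lam:]:], 0)"
  by (simp add: shift_s_simps(6,11) poly_scale_def) (simp add: const2_def t2_var_def mult.commute)

lemma L1_act_one: "omega_basis_act lam \<alpha> h (L 1) (const2 c, 0) =
    poly_scale (const2 c) ([:smult lam h, [:lam:]:], 0)"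
  by (simp add: shift_s_simps d_t2_simps poly_scale_def)
    (simp add: const2_def s_var_def in_t2_def h_poly_def mult.commute)

lemma poly_scale_const2_inj:
  assumes "c \<noteq> 0" "poly_scale (const2 c) v = poly_scale (const2 c) w"
  shows "v = w"
proof -
  have "const2 c \<noteq> 0"
    using assms(1) by (simp add: const2_def)
  then show ?thesis
    using assms(2) by (simp add: poly_scale_def prod_eq_iff)
qed

text \<open>
  Since the map is multiplication by a nonzero constant, \<open>W 1\<close> and \<open>L 1\<close> send \<open>1\<close> to the same
  elements in both modules, and comparing coefficients recovers all three parameters.
\<close>

lemma surj_even_intertwiner_parameters:
  assumes "intertwiner lam \<alpha> h \<mu> \<beta> g \<phi>" "snd (\<phi> (1, 0)) = 0" "surj \<phi>" "lam \<noteq> 0"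
  shows "lam = \<mu> \<and> \<alpha> = \<beta> \<and> h = g"
proof -
  obtain c where c: "c \<noteq> 0" "\<phi> (1, 0) = (const2 c, 0)"
    using surj_even_intertwiner_generator[OF assms(1-3)] .
  have \<phi>: "\<phi> (p, 0) = poly_scale (const2 c) (p, 0)" for p
    using intertwiner_generator[OF assms(1) c(2), of p 0] by (simp add: poly_scale_def mult.commute)
  have one: "poly_scale (const2 1) v = v" "\<phi> (const2 1, 0) = (const2 c, 0)" for v
    by (simp_all only: const2_simps(8) c(2)) (simp add: poly_scale_def)
  have "\<phi> ([:[:- lam * \<alpha>, lam:]:], 0) = poly_scale (const2 c) ([:[:- \<mu> * \<beta>, \<mu>:]:], 0)"
    using intertwiner_basis[OF assms(1), of "W 1" "(const2 1, 0)"]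
    unfolding W1_act_one one .
  then have W: "([:[:- lam * \<alpha>, lam:]:], 0) = ([:[:- \<mu> * \<beta>, \<mu>:]:], 0 :: poly2)"
    unfolding \<phi> by (rule poly_scale_const2_inj[OF c(1)])
  have "\<phi> ([:smult lam h, [:lam:]:], 0) = poly_scale (const2 c) ([:smult \<mu> g, [:\<mu>:]:], 0)"
    using intertwiner_basis[OF assms(1), of "L 1" "(const2 1, 0)"]
    unfolding L1_act_one one .
  then have L: "([:smult lam h, [:lam:]:], 0) = ([:smult \<mu> g, [:\<mu>:]:], 0 :: poly2)"
    unfolding \<phi> by (rule poly_scale_const2_inj[OF c(1)])
  from W \<open>lam \<noteq> 0\<close> have "lam = \<mu>" "\<alpha> = \<beta>" by auto
  moreover from L have "smult lam h = smult \<mu> g" unfolding prod.inject pCons_eq_iff by blast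
  then have "h = g"
    unfolding \<open>lam = \<mu>\<close>[symmetric] using \<open>lam \<noteq> 0\<close> by (rule smult_cancel[rotated])
  ultimately show ?thesis by blast
qed

lemma isomorphic_refl: "Omega lam \<alpha> h \<cong> Omega lam \<alpha> h"
  unfolding isomorphic_def
proof (intro exI conjI)
  show "Vector_Spaces.linear (scale (Omega lam \<alpha> h)) (scale (Omega lam \<alpha> h)) (\<lambda>v. v)"
    by (simp add: vector_space.linear_ident[OF vector_space_omega])
qed (simp_all add: bij_id[unfolded id_def])

theorem theorem2p6:
  fixes lam \<mu> \<alpha> \<beta> :: complex and h g :: "complex poly"
  assumes "lam \<noteq> 0" and "\<mu> \<noteq> 0"
  shows "(\<forall>lam' \<alpha>' h'. lam' \<noteq> 0 \<longrightarrow> \<not> (parity_change (Omega lam \<alpha> h) \<cong> Omega lam' \<alpha>' h')) \<and>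
         (Omega lam \<alpha> h \<cong> Omega \<mu> \<beta> g \<longleftrightarrow> lam = \<mu> \<and> \<alpha> = \<beta> \<and> h = g)"
proof (intro conjI allI impI notI iffI)
  fix lam' \<alpha>' h'
  assume "parity_change (Omega lam \<alpha> h) \<cong> Omega lam' \<alpha>' h'"
  then obtain \<phi> where \<phi>: "intertwiner lam \<alpha> h lam' \<alpha>' h' \<phi>" "bij \<phi>"
      "\<And>p. \<phi> ` part (Omega lam \<alpha> h) (p + 1) \<subseteq> part (Omega lam' \<alpha>' h') p"
    by (auto simp: isomorphic_def intertwiner_def parity_change_def)
  have "(1, 0) \<in> part (Omega lam \<alpha> h) (1 + 1)"
    by (simp add: Omega_part)
  then have "\<phi> (1, 0) \<in> part (Omega lam' \<alpha>' h') 1"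
    using \<phi>(3) by blast
  then have "fst (\<phi> (1, 0)) = 0"
    by (simp add: Omega_part)
  from not_surj_odd_intertwiner[OF \<phi>(1) this] bij_is_surj[OF \<phi>(2)]
  show False by contradiction
next
  assume "Omega lam \<alpha> h \<cong> Omega \<mu> \<beta> g"
  then obtain \<phi> where \<phi>: "intertwiner lam \<alpha> h \<mu> \<beta> g \<phi>" "bij \<phi>"
      "\<And>p. \<phi> ` part (Omega lam \<alpha> h) p \<subseteq> part (Omega \<mu> \<beta> g) p"
    by (auto simp: isomorphic_def intertwiner_def)
  have "(1, 0) \<in> part (Omega lam \<alpha> h) 0"
    by (simp add: Omega_part)
  then have "\<phi> (1, 0) \<in> part (Omega \<mu> \<beta> g) 0"
    using \<phi>(3) by blast
  then have "snd (\<phi> (1, 0)) = 0"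
    by (simp add: Omega_part)
  from surj_even_intertwiner_parameters[OF \<phi>(1) this bij_is_surj[OF \<phi>(2)] assms(1)]
  show "lam = \<mu>" "\<alpha> = \<beta>" "h = g" by simp_all
next
  assume "lam = \<mu> \<and> \<alpha> = \<beta> \<and> h = g"
  then show "Omega lam \<alpha> h \<cong> Omega \<mu> \<beta> g"
    using isomorphic_refl by simp
qed

end
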